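(* For every atomic system $S$ and every $p\in\mathsf{At}_\bot$, $p^i \Vdash^L_S p^c$.
   Context: Basic setting. Let $\mathsf{At}$ be a countably infinite set of atomic propositions and $\mathsf{At}_\bot=\mathsf{At}\cup\{\bot\}$. An atomic rule has the form "from premises $p_1,\dots,p_n$ ($n\ge 0$) infer $p$", with $p_j,p\in\mathsf{At}_\bot$, where the derivation of each premise may discharge a set of basic sentences. An atomic system $S$ is a set of atomic rules; $S\subseteq S'$ ($S'$ extends $S$) if $S'$ contains all rules of $S$. $\Delta\vdash_S p$ means there is a natural-deduction derivation using only rules of $S$ with conclusion $p$ and undischarged assumptions in $\Delta$ (so $p\vdash_S p$). $S$ is consistent if $\nvdash_S\bot$. Standing convention: all atomic systems (including all extensions quantified over) are required to be consistent. Ecumenical formulas: $p^i,p^c$ for $p\in\mathsf{At}_\bot$; $(A\wedge B)^x,(A\vee B)^x,(A\to B)^x$ for $x\in\{i,c\}$. $A\wedge B$, $A\vee B$, $A\to B$ abbreviate the $i$-versions, $\bot$ denotes $\bot^i$, $\neg A:=(A\to\bot^i)^i$; for $X^c$, $X^i$ is the same construction with outer superscript $i$. Weak validity (by simultaneous recursion): (1) $\Vdash^L_S p^i$ iff $\vdash_S p$ ($p\in\mathsf{At}_\bot$); (2) $\Vdash^L_S p^c$ iff $p\nvdash_S\bot$; (3) for non-atomic $X$, $\Vdash^L_S X^c$ iff $X^i\nVdash^L_S\bot$; (4) $\Vdash^L_S(A\wedge B)^i$ iff $\Vdash^L_S A$ and $\Vdash^L_S B$; (5) $\Vdash^L_S(A\to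 B)^i$ iff $A\Vdash^G_S B$; (6) $\Vdash^L_S(A\vee B)^i$ iff for all $S'\supseteq S$ and all $p\in\mathsf{At}_\bot$, if $A\Vdash^L_{S'}p^i$ and $B\Vdash^L_{S'}p^i$ then $\Vdash^L_{S'}p^i$; (7) for nonempty $\Gamma$, $\Gamma\Vdash^L_S A$ iff for all $S'\supseteq S$, if $\Vdash^L_{S'}B$ for all $B\in\Gamma$ then $\Vdash^L_{S'}A$; (8) $\Gamma\Vdash^G_S A$ iff for all $S'\supseteq S$: if $\Vdash^L_{S''}B$ for all $B\in\Gamma$ and all $S''\supseteq S'$, then $\Vdash^L_{S''}A$ for all $S''\supseteq S'$; (9) $\Gamma\Vdash A$ iff $\Gamma\Vdash^G_S A$ for all $S$. *)

theory Defs
  imports "HOL-Library.Countable" "HOL-Library.Infinite_Typeclass"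
begin

section \<open>Atomic systems\<close>

datatype 'a basic = At 'a | Bot

text \<open>A premise is a pair of the set of basic sentences its derivation may discharge and
  the basic sentence to be derived.\<close>

datatype 'a rule = Rule (prems: "('a basic set \<times> 'a basic) list") (conclusion: "'a basic")

type_synonym 'a system = "'a rule set"

text \<open>Natural-deduction derivation trees: a leaf is an assumption, an inner node is a rule
  application with one immediate subderivation per premise.\<close>

datatype 'a derivation = Assume "'a basic" | Infer "'a rule" "'a derivation list"

fun concl :: "'a derivation \<Rightarrow> 'a basic" where
  "concl (Assume p) = p"
| "concl (Infer r ds) = conclusion r"

fun uses_rules_of :: "'a system \<Rightarrow> 'a derivation \<Rightarrow> bool" where
  "uses_rules_of S (Assume p) \<longleftrightarrow> True"
| "uses_rules_of S (Infer r ds) \<longleftrightarrow>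
     r \<in> S \<and> map concl ds = map snd (prems r) \<and> (\<forall>d \<in> set ds. uses_rules_of S d)"

text \<open>A rule application discharges, above each premise, all assumptions that it is allowed
  to discharge there. Discharging fewer of them would only enlarge the set of undischarged
  assumptions, so this does not affect derivability.\<close>

primrec undischarged :: "'a derivation \<Rightarrow> 'a basic set" where
  "undischarged (Assume p) = {p}"
| "undischarged (Infer r ds) =
     \<Union> (set (map2 (\<lambda>\<Delta> prem. \<Delta> - fst prem) (map undischarged ds) (prems r)))"

definition derivable :: "'a system \<Rightarrow> 'a basic set \<Rightarrow> 'a basic \<Rightarrow> bool" where
  "derivable S \<Delta> p \<longleftrightarrow> (\<exists>d. uses_rules_of S d \<and> concl d = p \<and> undischarged d \<subseteq> \<Delta>)"

definition consistent :: "'a system \<Rightarrow> bool" where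
  "consistent S \<longleftrightarrow> \<not> derivable S {} Bot"

text \<open>All atomic systems, in particular all extensions, are required to be consistent.\<close>

definition extensions :: "'a system \<Rightarrow> 'a system set" where
  "extensions S = {S'. S \<subseteq> S' \<and> consistent S'}"


section \<open>Ecumenical formulas and weak validity\<close>

datatype mode = Intu | Clas  \<comment> \<open>the superscripts \<open>i\<close> and \<open>c\<close>\<close>

datatype 'a form =
    Atom "'a basic" mode
  | And "'a form" "'a form" mode
  | Or "'a form" "'a form" mode
  | Imp "'a form" "'a form" mode

text \<open>Weight for the termination proof: a classical formula is validated via its
  intuitionistic version, so it has to be heavier than the latter.\<close>

fun weight :: "'a form \<Rightarrow> nat" where
  "weight (Atom p x) = 0"
| "weight (And A B x) = weight A + weight B + (if x = Clas then 2 else 1)"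
| "weight (Or A B x) = weight A + weight B + (if x = Clas then 2 else 1)"
| "weight (Imp A B x) = weight A + weight B + (if x = Clas then 2 else 1)"

text \<open>\<open>valid S A\<close> is local validity of \<open>A\<close> in \<open>S\<close> without hypotheses. The
  local and global consequence relations occurring in the clauses for classical formulas,
  disjunction and implication are unfolded here; the lemmas \<open>valid_Clas\<close>,
  \<open>valid_Or_Intu\<close> and \<open>valid_Imp_Intu\<close> below restate these clauses in
  terms of the consequence relations.\<close>

function valid :: "'a system \<Rightarrow> 'a form \<Rightarrow> bool" where
  "valid S (Atom p Intu) \<longleftrightarrow> derivable S {} p"
| "valid S (Atom p Clas) \<longleftrightarrow> \<not> derivable S {p} Bot"
| "valid S (And A B Clas) \<longleftrightarrow>
     \<not> (\<forall>S' \<in> extensions S. valid S' (And A B Intu) \<longrightarrow> valid S' (Atom Bot Intu))"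
| "valid S (Or A B Clas) \<longleftrightarrow>
     \<not> (\<forall>S' \<in> extensions S. valid S' (Or A B Intu) \<longrightarrow> valid S' (Atom Bot Intu))"
| "valid S (Imp A B Clas) \<longleftrightarrow>
     \<not> (\<forall>S' \<in> extensions S. valid S' (Imp A B Intu) \<longrightarrow> valid S' (Atom Bot Intu))"
| "valid S (And A B Intu) \<longleftrightarrow> valid S A \<and> valid S B"
| "valid S (Imp A B Intu) \<longleftrightarrow>
     (\<forall>S' \<in> extensions S.
        (\<forall>S'' \<in> extensions S'. valid S'' A) \<longrightarrow> (\<forall>S'' \<in> extensions S'. valid S'' B))"
| "valid S (Or A B Intu) \<longleftrightarrow>
     (\<forall>S' \<in> extensions S. \<forall>p.
        (\<forall>S'' \<in> extensions S'. valid S'' A \<longrightarrow> valid S'' (Atom p Intu)) \<and>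
        (\<forall>S'' \<in> extensions S'. valid S'' B \<longrightarrow> valid S'' (Atom p Intu)) \<longrightarrow>
        valid S' (Atom p Intu))"
  by pat_completeness auto
termination
  by (relation "measure (\<lambda>(S, A). weight A)") auto

definition local_conseq :: "'a form set \<Rightarrow> 'a system \<Rightarrow> 'a form \<Rightarrow> bool" where
  "local_conseq \<Gamma> S A \<longleftrightarrow>
     (if \<Gamma> = {} then valid S A
      else \<forall>S' \<in> extensions S. (\<forall>B \<in> \<Gamma>. valid S' B) \<longrightarrow> valid S' A)"

definition global_conseq :: "'a form set \<Rightarrow> 'a system \<Rightarrow> 'a form \<Rightarrow> bool" where
  "global_conseq \<Gamma> S A \<longleftrightarrow>
     (\<forall>S' \<in> extensions S.
        (\<forall>B \<in> \<Gamma>. \<forall>S'' \<in> extensions S'. valid S'' B) \<longrightarrow>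
        (\<forall>S'' \<in> extensions S'. valid S'' A))"

lemma valid_Clas:
  "valid S (And A B Clas) \<longleftrightarrow> \<not> local_conseq {And A B Intu} S (Atom Bot Intu)"
  "valid S (Or A B Clas) \<longleftrightarrow> \<not> local_conseq {Or A B Intu} S (Atom Bot Intu)"
  "valid S (Imp A B Clas) \<longleftrightarrow> \<not> local_conseq {Imp A B Intu} S (Atom Bot Intu)"
  unfolding local_conseq_def valid.simps(3-5) by simp_all

lemma valid_Imp_Intu: "valid S (Imp A B Intu) \<longleftrightarrow> global_conseq {A} S B"
  unfolding global_conseq_def valid.simps(7) by simp

lemma valid_Or_Intu:
  "valid S (Or A B Intu) \<longleftrightarrow>
     (\<forall>S' \<in> extensions S. \<forall>p.
        local_conseq {A} S' (Atom p Intu) \<and> local_conseq {B} S' (Atom p Intu) \<longrightarrow>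
        local_conseq {} S' (Atom p Intu))"
  unfolding local_conseq_def valid.simps(8) by simp

end

theory Submission
  imports Defs
begin

primrec subst_assumption :: "'a basic \<Rightarrow> 'a derivation \<Rightarrow> 'a derivation \<Rightarrow> 'a derivation" where
  "subst_assumption p e (Assume q) = (if q = p then e else Assume q)"
| "subst_assumption p e (Infer r ds) = Infer r (map (subst_assumption p e) ds)"

lemma concl_subst_assumption:
  "concl e = p \<Longrightarrow> concl (subst_assumption p e d) = concl d"
  by (cases d) auto

text \<open>By \<open>concl_subst_assumption\<close> the subderivations at an \<open>Infer\<close>
  node keep their conclusions, so these still match the premises of the rule.\<close>

lemma uses_rules_of_subst_assumption:
  assumes "uses_rules_of S e" "concl e = p"
  shows "uses_rules_of S d \<Longrightarrow> uses_rules_of S (subst_assumption p e d)"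
  by (induction d) (auto simp: assms concl_subst_assumption cong: map_cong)

text \<open>Occurrences of \<open>p\<close> that get discharged are substituted as well, and open assumptions of
  \<open>e\<close> may be captured; both can only shrink the set of undischarged assumptions.\<close>

lemma undischarged_subst_assumption:
  "undischarged (subst_assumption p e d) \<subseteq> (undischarged d - {p}) \<union> undischarged e"
proof (induction d)
  case (Assume q)
  then show ?case by simp
next
  case (Infer r ds)
  show ?case
  proof
    fix x assume "x \<in> undischarged (subst_assumption p e (Infer r ds))"
    then obtain d \<pi> where d: "(d, \<pi>) \<in> set (zip ds (prems r))"
      and x: "x \<in> undischarged (subst_assumption p e d)" "x \<notin> fst \<pi>"
      by (auto simp: zip_map1)
    have "x \<in> (undischarged d - {p}) \<union> undischarged e"
      using Infer.IH[OF set_zip_leftD[OF d]] x(1) by blast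
    \<comment> \<open>If \<open>x\<close> is open in \<open>d\<close>, it stays open below the
      inference because \<open>fst \<pi>\<close> does not contain it.\<close>
    with d x(2) show "x \<in> (undischarged (Infer r ds) - {p}) \<union> undischarged e"
      by (force simp: zip_map1)
  qed
qed

text \<open>Grafting a derivation of \<open>p\<close> onto the leaves \<open>p\<close> of a
  derivation of \<open>q\<close> trades the assumption \<open>p\<close> for the open assumptions of
  the grafted derivation, which already lie in \<open>\<Delta>\<close>.\<close>

lemma derivable_cut:
  assumes "derivable S \<Delta> p" "derivable S (insert p \<Delta>) q"
  shows "derivable S \<Delta> q"
proof -
  obtain e where e: "uses_rules_of S e" "concl e = p" "undischarged e \<subseteq> \<Delta>"
    using assms(1) by (auto simp: derivable_def)
  obtain d where d: "uses_rules_of S d" "concl d = q" "undischarged d \<subseteq> insert p \<Delta>"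
    using assms(2) by (auto simp: derivable_def)
  have "undischarged (subst_assumption p e d) \<subseteq> \<Delta>"
    using undischarged_subst_assumption[of p e d] e(3) d(3) by blast
  then show ?thesis
    using e d by (auto simp: derivable_def concl_subst_assumption
        intro: uses_rules_of_subst_assumption)
qed

theorem theorem1:
  fixes S :: "'a :: {countable, infinite} system" and p :: "'a basic"
  assumes "consistent S"
  shows "local_conseq {Atom p Intu} S (Atom p Clas)"
  \<comment> \<open>Cut is used with empty \<open>\<Delta>\<close> and \<open>q = Bot\<close>: if an
    extension derived both \<open>p\<close> and, from \<open>p\<close>, \<open>Bot\<close>, it would
    derive \<open>Bot\<close> outright, against the consistency built into
    \<open>extensions\<close>.\<close>
  using derivable_cut by (auto simp: local_conseq_def extensions_def consistent_def)

end
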